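(* Let $R$ be an associative ring with unity $1$ and let $a,b,c\in R$. Then $a$ is dually $(b,c)$-polar if and only if $a$ is $(c,b)$-invertible. In this case, writing $r=a_{(b,c)\pi}^{r}$ and $s=a_{(b,c)\pi}^{l}$ for the dual right and dual left $(b,c)$-spectral idempotents of $a$, and $a^{\|(c,b)}$ for the $(c,b)$-inverse of $a$, one has: (i) $r=aa^{\|(c,b)}$; (ii) $s=a^{\|(c,b)}a$; (iii) $b$, $c$ and $bac$ are regular, and for any inner inverses $b^-$, $c^-$, $(bac)^-$ of $b$, $c$, $bac$ respectively, the element $1+s-cc^-$ is left invertible, the element $1+r-b^-b$ is right invertible, and $$a^{\|(c,b)}=(1+s-cc^-)_l^{-1}\,c(bac)^-b=c(bac)^-b\,(1+r-b^-b)_r^{-1},$$ where $(\cdot)_l^{-1}$ denotes any left inverse and $(\cdot)_r^{-1}$ any right inverse.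
   Context: An element $x\in R$ is regular if $x=xzx$ for some $z\in R$; any such $z$ is called an inner inverse of $x$ and is denoted $x^-$. Dually $(b,c)$-polar: $a$ is dually $(b,c)$-polar if there exist $r,s\in R$ such that (1) $r^2=r\in acRb$; (2) $s^2=s\in cRba$; (3) $br=b$ and $sc=c$; (4) $rac=ac$ and $bas=ba$. Here $acRb=\{actb:t\in R\}$ and $cRba=\{ctba:t\in R\}$. Such $r$ and $s$ are unique when they exist; $r$ is called the dual right $(b,c)$-spectral idempotent of $a$, denoted $a_{(b,c)\pi}^{r}$, and $s$ the dual left $(b,c)$-spectral idempotent of $a$, denoted $a_{(b,c)\pi}^{l}$. $(c,b)$-invertible: $a$ is $(c,b)$-invertible if there exists $y\in cR\cap Rb$ with $yac=c$ and $bay=b$. Such $y$ is unique when it exists; it is called the $(c,b)$-inverse of $a$ and denoted $a^{\|(c,b)}$. *)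

theory Defs
  imports Main
begin

text \<open>
  The sort \<open>{ring, monoid_mult}\<close> is that of associative, not necessarily commutative rings
  with unity. The class \<open>ring_1\<close> is avoided because it requires \<open>0 \<noteq> 1\<close>, which would exclude
  the zero ring.
\<close>

definition inner_inverse :: "'a::{ring,monoid_mult} \<Rightarrow> 'a \<Rightarrow> bool" where
  "inner_inverse x z \<longleftrightarrow> x = x * z * x"

definition regular :: "'a::{ring,monoid_mult} \<Rightarrow> bool" where
  "regular x \<longleftrightarrow> (\<exists>z. inner_inverse x z)"

definition left_inverse :: "'a::{ring,monoid_mult} \<Rightarrow> 'a \<Rightarrow> bool" where
  "left_inverse x l \<longleftrightarrow> l * x = 1"

definition right_inverse :: "'a::{ring,monoid_mult} \<Rightarrow> 'a \<Rightarrow> bool" where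
  "right_inverse x q \<longleftrightarrow> x * q = 1"

definition left_invertible :: "'a::{ring,monoid_mult} \<Rightarrow> bool" where
  "left_invertible x \<longleftrightarrow> (\<exists>l. left_inverse x l)"

definition right_invertible :: "'a::{ring,monoid_mult} \<Rightarrow> bool" where
  "right_invertible x \<longleftrightarrow> (\<exists>q. right_inverse x q)"

definition dual_spectral_pair :: "'a::{ring,monoid_mult} \<Rightarrow> 'a \<Rightarrow> 'a \<Rightarrow> 'a \<Rightarrow> 'a \<Rightarrow> bool" where
  "dual_spectral_pair b c a r s \<longleftrightarrow>
     r\<^sup>2 = r \<and> r \<in> {a * c * t * b | t. True} \<and>
     s\<^sup>2 = s \<and> s \<in> {c * t * b * a | t. True} \<and>
     b * r = b \<and> s * c = c \<and>
     r * a * c = a * c \<and> b * a * s = b * a"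

definition dually_polar :: "'a::{ring,monoid_mult} \<Rightarrow> 'a \<Rightarrow> 'a \<Rightarrow> bool" where
  "dually_polar b c a \<longleftrightarrow> (\<exists>r s. dual_spectral_pair b c a r s)"

definition dual_right_spectral_idem :: "'a::{ring,monoid_mult} \<Rightarrow> 'a \<Rightarrow> 'a \<Rightarrow> 'a" where
  "dual_right_spectral_idem b c a = (THE r. \<exists>s. dual_spectral_pair b c a r s)"

definition dual_left_spectral_idem :: "'a::{ring,monoid_mult} \<Rightarrow> 'a \<Rightarrow> 'a \<Rightarrow> 'a" where
  "dual_left_spectral_idem b c a = (THE s. \<exists>r. dual_spectral_pair b c a r s)"

text \<open>
  The first two arguments are in the order in which they occur in the name of the notion:
  \<open>is_pair_inverse c b a y\<close> says that \<open>y\<close> is a \<open>(c,b)\<close>-inverse of \<open>a\<close>.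
\<close>

definition is_pair_inverse :: "'a::{ring,monoid_mult} \<Rightarrow> 'a \<Rightarrow> 'a \<Rightarrow> 'a \<Rightarrow> bool" where
  "is_pair_inverse c b a y \<longleftrightarrow>
     y \<in> {c * t | t. True} \<inter> {t * b | t. True} \<and> y * a * c = c \<and> b * a * y = b"

definition pair_invertible :: "'a::{ring,monoid_mult} \<Rightarrow> 'a \<Rightarrow> 'a \<Rightarrow> bool" where
  "pair_invertible c b a \<longleftrightarrow> (\<exists>y. is_pair_inverse c b a y)"

definition pair_inverse :: "'a::{ring,monoid_mult} \<Rightarrow> 'a \<Rightarrow> 'a \<Rightarrow> 'a" where
  "pair_inverse c b a = (THE y. is_pair_inverse c b a y)"

text \<open>Uniqueness, so that the definite descriptions above denote the intended elements.\<close>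

lemma dual_spectral_pair_unique:
  assumes "dual_spectral_pair b c a r s" and "dual_spectral_pair b c a r' s'"
  shows "r = r'" and "s = s'"
proof -
  obtain t u where t: "r = a * c * t * b" and u: "s = c * u * b * a"
    using assms(1) unfolding dual_spectral_pair_def by blast
  obtain t' u' where t': "r' = a * c * t' * b" and u': "s' = c * u' * b * a"
    using assms(2) unfolding dual_spectral_pair_def by blast
  have eqs: "b * r' = b" "r * a * c = a * c" "b * a * s = b * a" "s' * c = c"
    using assms unfolding dual_spectral_pair_def by auto
  have "r * r' = r"
    using eqs(1) by (simp add: t mult.assoc)
  moreover have "r * r' = (r * a * c) * t' * b"
    by (simp add: t' mult.assoc)
  ultimately show "r = r'"
    using eqs(2) t' by simp
  have "s' * s = (s' * c) * u * b * a"
    by (simp add: u mult.assoc)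
  then have "s' * s = s"
    using eqs(4) u by simp
  moreover have "s' * s = c * u' * (b * a * s)"
    by (simp add: u' mult.assoc)
  ultimately show "s = s'"
    using eqs(3) u' by (simp add: mult.assoc)
qed

lemma is_pair_inverse_unique:
  assumes "is_pair_inverse c b a y" and "is_pair_inverse c b a y'"
  shows "y = y'"
proof -
  obtain u v where u: "y' = c * u" and v: "y = v * b"
    using assms unfolding is_pair_inverse_def by blast
  have eqs: "y * a * c = c" "b * a * y' = b"
    using assms unfolding is_pair_inverse_def by auto
  have "y * a * y' = (y * a * c) * u"
    by (simp add: u mult.assoc)
  then have "y * a * y' = y'"
    using eqs(1) u by simp
  moreover have "y * a * y' = v * (b * a * y')"
    by (simp add: v mult.assoc)
  ultimately show ?thesis
    using eqs(2) v by simp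
qed

end

theory Submission
  imports Defs
begin

text \<open>
  Both notions describe the same element \<open>y\<close>. The spectral idempotents are the left and right
  "supports" \<open>a y\<close> and \<open>y a\<close> of a \<open>(c,b)\<close>-inverse \<open>y\<close>; conversely, if \<open>r = a c t b\<close> is the right
  idempotent, then \<open>y = c t b\<close> is the \<open>(c,b)\<close>-inverse, and the left idempotent is what
  makes \<open>y a\<close> fix \<open>c\<close> (lemmas \<open>dual_spectral_pair_of_pair_inverse\<close> and
  \<open>pair_invertible_of_dual_spectral_pair\<close>). Uniqueness turns this into (i) and (ii).

  Part (iii) rests on two observations. First, \<open>y\<close> factors as \<open>c w b\<close>, and the identities
  \<open>y a c = c\<close>, \<open>b a y = b\<close> make \<open>c m b\<close> equal to \<open>y\<close> for every inner inverse \<open>m\<close> of \<open>b a c\<close>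
  (lemma \<open>pair_inverse_eq_inner\<close>). Secondly, \<open>y a\<close> and \<open>c c\<^sup>-\<close> are idempotents generating the
  same right ideal \<open>cR\<close>, while \<open>a y\<close> and \<open>b\<^sup>- b\<close> generate the same left ideal \<open>Rb\<close>. The
  difference of two such idempotents has square zero, so \<open>1\<close> plus this difference is a unit.
  It also annihilates \<open>y\<close> on the relevant side, whence the unit fixes \<open>y\<close>, and so does every
  one-sided inverse of it.
\<close>

section \<open>Idempotents generating the same one-sided ideal\<close>

lemma one_plus_mult_one_minus_of_square_zero:
  fixes n :: "'a::{ring,monoid_mult}"
  assumes "n * n = 0"
  shows "(1 + n) * (1 - n) = 1" and "(1 - n) * (1 + n) = 1"
  using assms by (simp_all add: distrib_left distrib_right left_diff_distrib right_diff_distrib)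

text \<open>
  The hypotheses say that \<open>e\<close> and \<open>f\<close> generate the same right ideal; all terms of the expanded
  square cancel in pairs. The next lemma is the mirror image.
\<close>

lemma square_zero_diff_same_right_ideal:
  fixes e f :: "'a::{ring,monoid_mult}"
  assumes "e * e = e" "f * f = f" "e * f = f" "f * e = e"
  shows "(e - f) * (e - f) = 0"
  using assms by (simp add: left_diff_distrib right_diff_distrib)

lemma square_zero_diff_same_left_ideal:
  fixes e f :: "'a::{ring,monoid_mult}"
  assumes "e * e = e" "f * f = f" "e * f = e" "f * e = f"
  shows "(e - f) * (e - f) = 0"
  using assms by (simp add: left_diff_distrib right_diff_distrib)

section \<open>Pair inverses and dual spectral pairs\<close>

lemma is_pair_inverseE:
  assumes "is_pair_inverse c b a y"
  obtains u v where "y = c * u" "y = v * b" "y * a * c = c" "b * a * y = b"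
  using assms unfolding is_pair_inverse_def by blast

text \<open>
  Since \<open>y\<close> lies in \<open>cR\<close> and \<open>y a\<close> fixes \<open>c\<close> from the left, \<open>y a\<close> fixes \<open>y\<close>.
\<close>

lemma pair_inverse_outer:
  assumes "is_pair_inverse c b a y"
  shows "y * a * y = y"
proof -
  obtain u where "y = c * u" "y * a * c = c"
    using assms by (rule is_pair_inverseE)
  then show ?thesis
    by (metis mult.assoc)
qed

text \<open>
  Membership in the intersection of \<open>cR\<close> and \<open>Rb\<close> improves to membership in \<open>cRb\<close>: replace the
  two outer factors of \<open>y = y a y\<close> by \<open>c u\<close> and \<open>v b\<close>.
\<close>

lemma pair_inverse_factor:
  assumes "is_pair_inverse c b a y"
  obtains w where "y = c * w * b"
proof -
  obtain u v where "y = c * u" "y = v * b"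
    using assms by (rule is_pair_inverseE)
  then have "y * a * y = (c * u) * a * (v * b)"
    by simp
  then have "y = c * (u * a * v) * b"
    using pair_inverse_outer[OF assms] by (simp add: mult.assoc)
  then show ?thesis
    by (rule that)
qed

lemma dual_spectral_pair_of_pair_inverse:
  assumes "is_pair_inverse c b a y"
  shows "dual_spectral_pair b c a (a * y) (y * a)"
proof -
  obtain w where w: "y = c * w * b"
    using assms by (rule pair_inverse_factor)
  have outer: "y * a * y = y"
    using assms by (rule pair_inverse_outer)
  have fix_c: "y * a * c = c" and fix_b: "b * a * y = b"
    using assms by (auto elim: is_pair_inverseE)
  have "(a * y)\<^sup>2 = a * (y * a * y)" and "(y * a)\<^sup>2 = (y * a * y) * a"
    by (simp_all only: power2_eq_square mult.assoc)
  then have "(a * y)\<^sup>2 = a * y" and "(y * a)\<^sup>2 = y * a"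
    by (simp_all only: outer)
  moreover have "a * y = a * c * w * b" and "y * a = c * w * b * a"
    by (simp_all add: w mult.assoc)
  moreover have "b * (a * y) = b"
    using fix_b by (simp add: mult.assoc)
  moreover have "a * y * a * c = a * c"
    using fix_c by (simp add: mult.assoc)
  moreover have "b * a * (y * a) = b * a"
    using fix_b by (metis mult.assoc)
  ultimately show ?thesis
    unfolding dual_spectral_pair_def using fix_c by blast
qed

lemma pair_invertible_of_dual_spectral_pair:
  assumes "dual_spectral_pair b c a r s"
  shows "pair_invertible c b a"
proof -
  obtain t u where r: "r = a * c * t * b" and s: "s = c * u * b * a"
    using assms unfolding dual_spectral_pair_def by blast
  have br: "b * r = b" and sc: "s * c = c" and rac: "r * a * c = a * c"
    using assms unfolding dual_spectral_pair_def by auto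
  define y where "y = c * t * b"
  have ay: "a * y = r"
    by (simp add: y_def r mult.assoc)
  \<comment> \<open>As \<open>s\<close> fixes \<open>c\<close>, it may be inserted in front of \<open>y\<close>, which brings \<open>r = a y\<close> into play.\<close>
  have "y * a * c = (s * c) * t * b * a * c"
    by (simp add: sc y_def)
  also have "\<dots> = c * u * b * ((a * y) * a * c)"
    by (simp add: s y_def mult.assoc)
  also have "\<dots> = c * u * b * (a * c)"
    by (simp only: ay rac)
  also have "\<dots> = s * c"
    by (simp add: s mult.assoc)
  finally have "y * a * c = c"
    using sc by simp
  moreover have "b * a * y = b"
    using ay br by (simp add: mult.assoc)
  moreover have "y = c * (t * b)" and "y = (c * t) * b"
    by (simp_all add: y_def mult.assoc)
  ultimately have "is_pair_inverse c b a y"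
    unfolding is_pair_inverse_def by blast
  then show ?thesis
    unfolding pair_invertible_def by blast
qed

lemma pair_inverse_eq:
  assumes "is_pair_inverse c b a y"
  shows "pair_inverse c b a = y"
  unfolding pair_inverse_def
  using assms is_pair_inverse_unique[OF _ assms] by (rule the_equality)

lemma dual_spectral_idems_eq:
  assumes "dual_spectral_pair b c a r s"
  shows "dual_right_spectral_idem b c a = r" and "dual_left_spectral_idem b c a = s"
  unfolding dual_right_spectral_idem_def dual_left_spectral_idem_def
  using assms dual_spectral_pair_unique[OF _ assms] by (blast intro: the_equality)+

section \<open>Inner inverses\<close>

lemma pair_inverse_regular:
  assumes "is_pair_inverse c b a y"
  shows "regular b" and "regular c" and "regular (b * a * c)"
proof -
  obtain u v where u: "y = c * u" and v: "y = v * b"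
      and fix_c: "y * a * c = c" and fix_b: "b * a * y = b"
    using assms by (rule is_pair_inverseE)
  obtain w where w: "y = c * w * b"
    using assms by (rule pair_inverse_factor)
  have "b = b * (a * v) * b"
    using fix_b v by (simp add: mult.assoc)
  then show "regular b"
    unfolding regular_def inner_inverse_def by blast
  have "c = c * (u * a) * c"
    using fix_c u by (simp add: mult.assoc)
  then show "regular c"
    unfolding regular_def inner_inverse_def by blast
  have "(b * a * c) * w * (b * a * c) = (b * a * y) * a * c"
    by (simp add: w mult.assoc)
  then have "b * a * c = (b * a * c) * w * (b * a * c)"
    by (simp add: fix_b)
  then show "regular (b * a * c)"
    unfolding regular_def inner_inverse_def by blast
qed

text \<open>
  Both equal \<open>y a (c m b) a y\<close>: the outer factors \<open>y a\<close> and \<open>a y\<close> are absorbed by \<open>c\<close> and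
  \<open>b\<close>, whereas writing them with \<open>y = c w b\<close> produces the product \<open>(b a c) m (b a c)\<close>, in which
  \<open>m\<close> disappears.
\<close>

lemma pair_inverse_eq_inner:
  assumes y: "is_pair_inverse c b a y" and m: "inner_inverse (b * a * c) m"
  shows "y = c * m * b"
proof -
  obtain w where w: "y = c * w * b"
    using y by (rule pair_inverse_factor)
  have fix_c: "y * a * c = c" and fix_b: "b * a * y = b"
    using y by (auto elim: is_pair_inverseE)
  have "c * m * b = (y * a * c) * m * (b * a * y)"
    by (simp only: fix_c fix_b)
  also have "\<dots> = c * w * ((b * a * c) * m * (b * a * c)) * w * b"
    by (simp add: w mult.assoc)
  also have "\<dots> = c * w * (b * a * c) * w * b"
    using m unfolding inner_inverse_def by simp
  also have "\<dots> = y * a * y"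
    by (simp add: w mult.assoc)
  also have "\<dots> = y"
    using y by (rule pair_inverse_outer)
  finally show ?thesis ..
qed

text \<open>
  The idempotents \<open>y a\<close> and \<open>c c'\<close> both generate the right ideal \<open>cR\<close>, which contains \<open>y\<close>;
  hence their difference has square zero and annihilates \<open>y\<close> from the left.
\<close>

lemma pair_inverse_left_unit:
  assumes y: "is_pair_inverse c b a y" and c': "inner_inverse c c'"
  shows "left_invertible (1 + y * a - c * c')"
    and "(1 + y * a - c * c') * y = y"
proof -
  obtain u where u: "y = c * u" and fix_c: "y * a * c = c"
    using y by (rule is_pair_inverseE)
  have cc: "c * c' * c = c"
    using c' unfolding inner_inverse_def by simp
  have outer: "y * a * y = y"
    using y by (rule pair_inverse_outer)
  have fix_y: "c * c' * y = y"
    using cc u by (metis mult.assoc)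
  have "(y * a) * (y * a) = y * a"
    using outer by (metis mult.assoc)
  moreover have "(c * c') * (c * c') = c * c'"
    using cc by (metis mult.assoc)
  moreover have "(y * a) * (c * c') = c * c'"
    using fix_c by (metis mult.assoc)
  moreover have "(c * c') * (y * a) = y * a"
    using fix_y by (metis mult.assoc)
  ultimately have "(y * a - c * c') * (y * a - c * c') = 0"
    by (rule square_zero_diff_same_right_ideal)
  then have "(1 - (y * a - c * c')) * (1 + (y * a - c * c')) = 1"
    by (rule one_plus_mult_one_minus_of_square_zero)
  then show "left_invertible (1 + y * a - c * c')"
    unfolding left_invertible_def left_inverse_def add_diff_eq by blast
  show "(1 + y * a - c * c') * y = y"
    by (simp add: distrib_right left_diff_distrib outer fix_y)
qed

lemma pair_inverse_right_unit:
  assumes y: "is_pair_inverse c b a y" and b': "inner_inverse b b'"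
  shows "right_invertible (1 + a * y - b' * b)"
    and "y * (1 + a * y - b' * b) = y"
proof -
  obtain v where v: "y = v * b" and fix_b: "b * a * y = b"
    using y by (rule is_pair_inverseE)
  have bb: "b * b' * b = b"
    using b' unfolding inner_inverse_def by simp
  have outer: "y * (a * y) = y"
    using pair_inverse_outer[OF y] by (simp add: mult.assoc)
  have fix_y: "y * (b' * b) = y"
    using bb v by (metis mult.assoc)
  have "(a * y) * (a * y) = a * y"
    using outer by (metis mult.assoc)
  moreover have "(b' * b) * (b' * b) = b' * b"
    using bb by (metis mult.assoc)
  moreover have "(a * y) * (b' * b) = a * y"
    using fix_y by (metis mult.assoc)
  moreover have "(b' * b) * (a * y) = b' * b"
    using fix_b by (metis mult.assoc)
  ultimately have "(a * y - b' * b) * (a * y - b' * b) = 0"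
    by (rule square_zero_diff_same_left_ideal)
  then have "(1 + (a * y - b' * b)) * (1 - (a * y - b' * b)) = 1"
    by (rule one_plus_mult_one_minus_of_square_zero)
  then show "right_invertible (1 + a * y - b' * b)"
    unfolding right_invertible_def right_inverse_def add_diff_eq by blast
  show "y * (1 + a * y - b' * b) = y"
    by (simp add: distrib_left right_diff_distrib outer fix_y)
qed

section \<open>Dual polarity is pair invertibility\<close>

theorem theorem3p4:
  fixes a b c :: "'a::{ring,monoid_mult}"
  shows "(dually_polar b c a \<longleftrightarrow> pair_invertible c b a) \<and>
    (dually_polar b c a \<longrightarrow>
      (let r = dual_right_spectral_idem b c a;
           s = dual_left_spectral_idem b c a;
           y = pair_inverse c b a
       in r = a * y \<and>
          s = y * a \<and>
          regular b \<and> regular c \<and> regular (b * a * c) \<and>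
          (\<forall>b' c' m. inner_inverse b b' \<and> inner_inverse c c' \<and> inner_inverse (b * a * c) m \<longrightarrow>
             left_invertible (1 + s - c * c') \<and>
             right_invertible (1 + r - b' * b) \<and>
             (\<forall>l. left_inverse (1 + s - c * c') l \<longrightarrow> y = l * (c * m * b)) \<and>
             (\<forall>q. right_inverse (1 + r - b' * b) q \<longrightarrow> y = (c * m * b) * q))))"
proof (intro conjI impI)
  show equiv: "dually_polar b c a \<longleftrightarrow> pair_invertible c b a"
    using pair_invertible_of_dual_spectral_pair dual_spectral_pair_of_pair_inverse
    unfolding dually_polar_def pair_invertible_def by metis
  assume "dually_polar b c a"
  then obtain y where y: "is_pair_inverse c b a y"
    using equiv unfolding pair_invertible_def by blast
  note eqs = pair_inverse_eq[OF y]
    dual_spectral_idems_eq[OF dual_spectral_pair_of_pair_inverse[OF y]]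
  have left: "y = l * (c * m * b)"
    if "inner_inverse c c'" "inner_inverse (b * a * c) m"
      and l: "left_inverse (1 + y * a - c * c') l" for c' m l
  proof -
    have "y = (l * (1 + y * a - c * c')) * y"
      using l unfolding left_inverse_def by simp
    also have "\<dots> = l * y"
      by (simp only: mult.assoc pair_inverse_left_unit(2)[OF y that(1)])
    finally show ?thesis
      using pair_inverse_eq_inner[OF y that(2)] by simp
  qed
  have right: "y = (c * m * b) * q"
    if "inner_inverse b b'" "inner_inverse (b * a * c) m"
      and q: "right_inverse (1 + a * y - b' * b) q" for b' m q
  proof -
    have "y = y * ((1 + a * y - b' * b) * q)"
      using q unfolding right_inverse_def by simp
    also have "\<dots> = y * q"
      by (simp only: mult.assoc[symmetric] pair_inverse_right_unit(2)[OF y that(1)])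
    finally show ?thesis
      using pair_inverse_eq_inner[OF y that(2)] by simp
  qed
  show "let r = dual_right_spectral_idem b c a;
           s = dual_left_spectral_idem b c a;
           y = pair_inverse c b a
       in r = a * y \<and>
          s = y * a \<and>
          regular b \<and> regular c \<and> regular (b * a * c) \<and>
          (\<forall>b' c' m. inner_inverse b b' \<and> inner_inverse c c' \<and> inner_inverse (b * a * c) m \<longrightarrow>
             left_invertible (1 + s - c * c') \<and>
             right_invertible (1 + r - b' * b) \<and>
             (\<forall>l. left_inverse (1 + s - c * c') l \<longrightarrow> y = l * (c * m * b)) \<and>
             (\<forall>q. right_inverse (1 + r - b' * b) q \<longrightarrow> y = (c * m * b) * q))"
    unfolding Let_def eqs
    using pair_inverse_regular[OF y] pair_inverse_left_unit(1)[OF y]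
      pair_inverse_right_unit(1)[OF y] left right
    by blast
qed

end
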